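(* For every integer $n\ge 0$ there is a bijection $\Phi$ from the set of relaxed binary trees of size $n$ with right height at most one onto the set of plane increasing trees of size $n$ with the following property. Let $\mathcal R$ be such a relaxed binary tree, let $v_0,v_1,\dots,v_n$ be its nodes (the $n$ internal nodes and the unique leaf) listed in inorder of the underlying binary tree, and let $\mathcal T=\Phi(\mathcal R)$. Then for every $k\in\{1,\dots,n\}$, the node $v_k$ lies on level $0$ of $\mathcal R$ if and only if the node with label $k$ is a maximal young leaf of $\mathcal T_k$.
   Context: A binary tree of size $n$ is a rooted plane tree with $n$ internal nodes, each having an ordered left and right child, and $n+1$ leaves. A relaxed binary tree of size $n$ is obtained from a binary tree of size $n$ by keeping the first leaf in postorder traversal (this becomes the unique leaf) and replacing every other leaf by a pointer to some node (internal node or the kept leaf) that has already been visited in the postorder traversal when that leaf position is reached. Two relaxed binary trees are equal iff they have the same underlying binary tree and the same pointer targets. The size is the number of internal nodes; the size-$0$ object is a single leaf. The underlying binary tree is the tree obtained by deleting all pointers (internal nodes and the leaf, with their tree edges). The level of a node is the number of right edges on the path from the root to it in the underlying binary tree; the right height is the maximal number of right edges on any path from the root to a leaf in the underlying binary tree. Inorder: visit the left subtree, then the node, then the right subtree (pointers ignored); in particular $v_0$ is the leaf. A plane increasing tree of size $n$ is a rooted plane (ordered) tree with $n+1$ nodes labelled bijectively by $0,1,\dots,n$ such that labels increase along every path starting at the root. For such a tree $\mathcal T$, $\mathcal T_k$ denotes the tree restricted to the nodes with labels $0,\dots,k$. A young leaf is a leaf without a left sibling; a maximal young leaf of a tree is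 a young leaf whose label is maximal among all young leaves of that tree. *)

theory Defs
  imports "HOL-Library.Tree"
begin

section \<open>Relaxed binary trees\<close>

text \<open>
  A node or leaf of a binary tree is identified with the sequence of edges leading to it from the
  root. The shape of a binary tree is a \<^typ>\<open>unit tree\<close>; its \<^const>\<open>size\<close> is the number of
  internal nodes.
\<close>

datatype edge = LeftEdge | RightEdge

type_synonym pos = "edge list"

primrec internal_positions :: "unit tree \<Rightarrow> pos set" where
  "internal_positions Leaf = {}"
| "internal_positions (Node l x r) =
     insert [] ((#) LeftEdge ` internal_positions l \<union> (#) RightEdge ` internal_positions r)"

primrec leaf_positions :: "unit tree \<Rightarrow> pos set" where
  "leaf_positions Leaf = {[]}"
| "leaf_positions (Node l x r) =
     (#) LeftEdge ` leaf_positions l \<union> (#) RightEdge ` leaf_positions r"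

text \<open>Both traversals list the internal nodes as well as the leaves.\<close>

primrec postorder_positions :: "unit tree \<Rightarrow> pos list" where
  "postorder_positions Leaf = [[]]"
| "postorder_positions (Node l x r) =
     map ((#) LeftEdge) (postorder_positions l) @ map ((#) RightEdge) (postorder_positions r) @ [[]]"

primrec inorder_positions :: "unit tree \<Rightarrow> pos list" where
  "inorder_positions Leaf = [[]]"
| "inorder_positions (Node l x r) =
     map ((#) LeftEdge) (inorder_positions l) @ [[]] @ map ((#) RightEdge) (inorder_positions r)"

definition visited_before :: "unit tree \<Rightarrow> pos \<Rightarrow> pos set" where
  "visited_before t p = set (takeWhile (\<lambda>q. q \<noteq> p) (postorder_positions t))"

definition kept_leaf :: "unit tree \<Rightarrow> pos" where
  "kept_leaf t = hd (filter (\<lambda>p. p \<in> leaf_positions t) (postorder_positions t))"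

text \<open>The nodes of the underlying binary tree, that is, what remains once all pointers are deleted.\<close>

definition tree_nodes :: "unit tree \<Rightarrow> pos set" where
  "tree_nodes t = insert (kept_leaf t) (internal_positions t)"

text \<open>
  The second component maps every leaf position other than the kept leaf to its pointer target.
  Since the domain of this map is fixed, equality of pairs is equality of the underlying
  binary trees together with all pointer targets.
\<close>

type_synonym relaxed_tree = "unit tree \<times> (pos \<rightharpoonup> pos)"

definition relaxed_trees :: "nat \<Rightarrow> relaxed_tree set" where
  "relaxed_trees n = {(t, ptr). size t = n \<and>
     dom ptr = leaf_positions t - {kept_leaf t} \<and>
     (\<forall>p q. ptr p = Some q \<longrightarrow> q \<in> tree_nodes t \<inter> visited_before t p)}"

definition level :: "pos \<Rightarrow> nat" where
  "level p = count_list p RightEdge"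

text \<open>
  The leaves of the underlying binary tree are its childless nodes. As the pointers have been
  deleted, these include the internal nodes both of whose children are pointers.
\<close>

definition underlying_leaves :: "relaxed_tree \<Rightarrow> pos set" where
  "underlying_leaves r = {p \<in> tree_nodes (fst r). \<forall>e. p @ [e] \<notin> tree_nodes (fst r)}"

definition right_height :: "relaxed_tree \<Rightarrow> nat" where
  "right_height r = Max (level ` underlying_leaves r)"

definition inorder_nodes :: "relaxed_tree \<Rightarrow> pos list" where
  "inorder_nodes r = filter (\<lambda>p. p \<in> tree_nodes (fst r)) (inorder_positions (fst r))"

section \<open>Plane increasing trees\<close>

datatype plane_tree = PNode (root_label: nat) (children: "plane_tree list")

primrec labels :: "plane_tree \<Rightarrow> nat list" where
  "labels (PNode a ts) = a # concat (map labels ts)"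

primrec subtrees_of :: "plane_tree \<Rightarrow> plane_tree set" where
  "subtrees_of (PNode a ts) = insert (PNode a ts) (\<Union> (set (map subtrees_of ts)))"

definition increasing :: "plane_tree \<Rightarrow> bool" where
  "increasing T \<longleftrightarrow> (\<forall>S \<in> subtrees_of T. \<forall>C \<in> set (children S). root_label S < root_label C)"

definition plane_increasing_trees :: "nat \<Rightarrow> plane_tree set" where
  "plane_increasing_trees n =
     {T. distinct (labels T) \<and> set (labels T) = {0..n} \<and> increasing T}"

text \<open>
  Cutting off every branch whose root has a label greater than \<open>k\<close> is the restriction to the labels
  \<open>0, \<dots>, k\<close> because labels increase along branches; the root itself, which carries the label
  \<open>0\<close>, is always kept.
\<close>

primrec restrict_tree :: "nat \<Rightarrow> plane_tree \<Rightarrow> plane_tree" where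
  "restrict_tree k (PNode a ts) =
     PNode a (filter (\<lambda>t. root_label t \<le> k) (map (restrict_tree k) ts))"

text \<open>The following predicates refer to nodes by their labels, which are assumed to be distinct.\<close>

definition is_leaf :: "plane_tree \<Rightarrow> nat \<Rightarrow> bool" where
  "is_leaf T a \<longleftrightarrow> PNode a [] \<in> subtrees_of T"

definition has_left_sibling :: "plane_tree \<Rightarrow> nat \<Rightarrow> bool" where
  "has_left_sibling T a \<longleftrightarrow> (\<exists>S \<in> subtrees_of T. \<exists>i j.
     i < j \<and> j < length (children S) \<and> root_label (children S ! j) = a)"

definition young_leaf :: "plane_tree \<Rightarrow> nat \<Rightarrow> bool" where
  "young_leaf T a \<longleftrightarrow> is_leaf T a \<and> \<not> has_left_sibling T a"

definition maximal_young_leaf :: "plane_tree \<Rightarrow> nat \<Rightarrow> bool" where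
  "maximal_young_leaf T a \<longleftrightarrow> young_leaf T a \<and> (\<forall>b. young_leaf T b \<longrightarrow> b \<le> a)"

end

theory Submission
  imports Defs "HOL-Library.FuncSet" "HOL-Library.Multiset"
begin

text \<open>
  It suffices to count: for every set \<open>w\<close> of indices, both the relaxed trees whose level-\<open>0\<close> nodes
  \<open>v\<^sub>k\<close>, \<open>k \<ge> 1\<close>, are those with \<open>k \<in> w\<close> and the increasing trees whose label \<open>k\<close> is a maximal young
  leaf on insertion exactly for \<open>k \<in> w\<close> number \<open>\<Prod>\<^sub>k (if k \<in> w then k else k - 1)\<close>.

  An increasing tree grows by inserting the labels one after the other. As \<open>k\<close> is the largest label
  when it arrives, it is a maximal young leaf iff it becomes a first child, for which there are \<open>k\<close>
  places, one below each node; the other \<open>k - 1\<close> places are to the right of the non-root nodes.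

  For relaxed trees of right height at most one the sequence of levels in inorder determines the
  shape. Appending a node on level \<open>0\<close> adds a new root whose right child is a pointer with \<open>k\<close>
  possible targets; appending a node on level \<open>1\<close> puts it on top of the right subtree of the root,
  and its right child is a pointer with \<open>k - 1\<close> possible targets, as the root is not yet visited.
\<close>

section \<open>Gluing bijections over fibres and counting partial maps\<close>

text \<open>The fibres of \<open>f\<close> and \<open>g\<close> partition \<open>A\<close> and
  \<open>B\<close>, so bijections chosen separately over each value \<open>w\<close> glue to one
  that carries \<open>f\<close> to \<open>g\<close>. Finiteness is what turns equal
  \<open>card\<close> into a bijection.\<close>

lemma bij_betw_fibrewise:
  assumes fin: "\<And>w. finite {a \<in> A. f a = w}" "\<And>w. finite {b \<in> B. g b = w}"
    and card: "\<And>w. card {a \<in> A. f a = w} = card {b \<in> B. g b = w}"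
  shows "\<exists>h. bij_betw h A B \<and> (\<forall>a\<in>A. g (h a) = f a)"
proof -
  have "\<forall>w. \<exists>h. bij_betw h {a \<in> A. f a = w} {b \<in> B. g b = w}"
    by (intro allI finite_same_card_bij fin card)
  then obtain h where h: "\<And>w. bij_betw (h w) {a \<in> A. f a = w} {b \<in> B. g b = w}"
    unfolding choice_iff by blast
  have val: "h (f a) a \<in> B \<and> g (h (f a) a) = f a" if "a \<in> A" for a
    using bij_betwE[OF h[of "f a"]] that by blast
  have "inj_on (\<lambda>a. h (f a) a) A"
  proof (rule inj_onI)
    fix a a' assume A: "a \<in> A" "a' \<in> A" and eq: "h (f a) a = h (f a') a'"
    have "f a = f a'" using val[OF A(1)] val[OF A(2)] eq by simp
    then show "a = a'"
      using bij_betw_imp_inj_on[OF h[of "f a"]] A eq by (auto dest: inj_onD)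
  qed
  moreover have "b \<in> (\<lambda>a. h (f a) a) ` A" if "b \<in> B" for b
    using bij_betw_imp_surj_on[OF h[of "g b"]] that by force
  ultimately have "bij_betw (\<lambda>a. h (f a) a) A B"
    using val by (auto simp: bij_betw_def)
  then show ?thesis using val by (intro exI[of _ "\<lambda>a. h (f a) a"]) auto
qed

text \<open>These partial maps are the extensional functions of \<open>PiE D S\<close> in another
  encoding, with \<open>None\<close> for the values outside \<open>D\<close>.\<close>

lemma card_maps_dom:
  assumes "finite D" "\<And>p. p \<in> D \<Longrightarrow> finite (S p)"
  shows "finite {m. dom m = D \<and> (\<forall>p q. m p = Some q \<longrightarrow> q \<in> S p)} \<and>
    card {m. dom m = D \<and> (\<forall>p q. m p = Some q \<longrightarrow> q \<in> S p)} = (\<Prod>p\<in>D. card (S p))"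
proof -
  let ?M = "{m. dom m = D \<and> (\<forall>p q. m p = Some q \<longrightarrow> q \<in> S p)}"
  let ?F = "\<lambda>f p. if p \<in> D then Some (f p) else None"
  let ?G = "\<lambda>m. restrict (\<lambda>p. the (m p)) D"
  have bij: "bij_betw ?F (PiE D S) ?M"
  proof (rule bij_betw_byWitness[where f' = ?G])
    show "\<forall>a\<in>PiE D S. ?G (?F a) = a" by (auto simp: fun_eq_iff PiE_def extensional_def)
    show "\<forall>a'\<in>?M. ?F (?G a') = a'" by (auto simp: fun_eq_iff dom_def)
    show "?F ` PiE D S \<subseteq> ?M" by (auto simp: dom_def split: if_splits)
    show "?G ` ?M \<subseteq> PiE D S" by (force simp: dom_def)
  qed
  have "finite (PiE D S)" using assms by (intro finite_PiE)
  then show ?thesis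
    using bij_betw_finite[OF bij] bij_betw_same_card[OF bij] card_PiE[OF assms(1), of S] by simp
qed

section \<open>Relaxed trees with a given sequence of levels\<close>

lemma finite_internal_positions [simp]: "finite (internal_positions t)"
  by (induction t) auto

lemma finite_leaf_positions [simp]: "finite (leaf_positions t)"
  by (induction t) auto

lemma disjoint_edge_images [simp]: "(#) LeftEdge ` A \<inter> (#) RightEdge ` B = {}"
  by auto

lemma card_internal_positions [simp]: "card (internal_positions t) = size t"
  by (induction t) (auto simp: card_insert_if card_Un_disjoint card_image)

lemma set_postorder_positions: "set (postorder_positions t) = internal_positions t \<union> leaf_positions t"
  by (induction t) auto

lemma leaf_not_internal: "p \<in> leaf_positions t \<Longrightarrow> p \<notin> internal_positions t"
  by (induction t arbitrary: p) auto

lemma postorder_positions_nonempty [simp]: "postorder_positions t \<noteq> []"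
  by (cases t) auto

lemma hd_postorder_leaf: "hd (postorder_positions t) \<in> leaf_positions t"
  by (induction t) (auto simp: hd_append hd_map)

lemma kept_leaf_eq_hd: "kept_leaf t = hd (postorder_positions t)"
  using hd_postorder_leaf[of t] unfolding kept_leaf_def
  by (cases "postorder_positions t") auto

lemma kept_leaf_simps [simp]:
  "kept_leaf Leaf = []"
  "kept_leaf (Node l x r) = LeftEdge # kept_leaf l"
  by (auto simp: kept_leaf_eq_hd hd_append hd_map)

lemma kept_leaf_in [simp]: "kept_leaf t \<in> leaf_positions t"
  using hd_postorder_leaf[of t] by (simp add: kept_leaf_eq_hd)

lemma level_simps [simp]:
  "level [] = 0" "level (LeftEdge # p) = level p" "level (RightEdge # p) = Suc (level p)"
  by (auto simp: level_def)

lemma level_kept_leaf [simp]: "level (kept_leaf t) = 0"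
  by (induction t) auto

lemma visited_before_kept_leaf: "visited_before t (kept_leaf t) = {}"
  unfolding visited_before_def kept_leaf_eq_hd
  by (cases "postorder_positions t") auto

lemma kept_leaf_visited_before: "p \<noteq> kept_leaf t \<Longrightarrow> kept_leaf t \<in> visited_before t p"
  unfolding visited_before_def kept_leaf_eq_hd
  by (cases "postorder_positions t") auto

lemma visited_before_LeftEdge:
  assumes "p \<in> leaf_positions l"
  shows "visited_before (Node l x r) (LeftEdge # p) = (#) LeftEdge ` visited_before l p"
proof -
  have "p \<in> set (postorder_positions l)" using assms by (simp add: set_postorder_positions)
  then have "takeWhile (\<lambda>q. q \<noteq> LeftEdge # p) (postorder_positions (Node l x r)) =
      map ((#) LeftEdge) (takeWhile (\<lambda>q. q \<noteq> p) (postorder_positions l))"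
    by (simp add: takeWhile_append1[of "LeftEdge # p"] takeWhile_map comp_def)
  then show ?thesis
    unfolding visited_before_def by simp
qed

text \<open>On entering the right subtree, postorder has completed the left one but has not yet
  reached the root.\<close>

lemma visited_before_RightEdge:
  assumes "p \<in> leaf_positions r"
  shows "visited_before (Node l x r) (RightEdge # p) =
    (#) LeftEdge ` (internal_positions l \<union> leaf_positions l) \<union> (#) RightEdge ` visited_before r p"
proof -
  have "p \<in> set (postorder_positions r)" using assms by (simp add: set_postorder_positions)
  then have "takeWhile (\<lambda>q. q \<noteq> RightEdge # p) (postorder_positions (Node l x r)) =
      map ((#) LeftEdge) (postorder_positions l) @
      map ((#) RightEdge) (takeWhile (\<lambda>q. q \<noteq> p) (postorder_positions r))"
    by (subst postorder_positions.simps, subst takeWhile_append2)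
      (auto simp: takeWhile_append1[of "RightEdge # p"] takeWhile_map comp_def)
  then show ?thesis
    unfolding visited_before_def by (simp add: set_postorder_positions)
qed

section \<open>Counting pointer targets\<close>

text \<open>The kept leaf is left out because it depends on the whole tree: the first leaf of a
  right subtree is a pointer. Without it the count passes cleanly to subtrees.\<close>

definition internal_before :: "unit tree \<Rightarrow> pos \<Rightarrow> nat" where
  "internal_before t p = card (internal_positions t \<inter> visited_before t p)"

lemma internal_before_LeftEdge:
  assumes "p \<in> leaf_positions l"
  shows "internal_before (Node l x r) (LeftEdge # p) = internal_before l p"
proof -
  have "internal_positions (Node l x r) \<inter> visited_before (Node l x r) (LeftEdge # p) =
      (#) LeftEdge ` (internal_positions l \<inter> visited_before l p)"
    using assms by (auto simp: visited_before_LeftEdge)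
  then show ?thesis unfolding internal_before_def by (simp add: card_image)
qed

lemma internal_before_RightEdge:
  assumes "p \<in> leaf_positions r"
  shows "internal_before (Node l x r) (RightEdge # p) = size l + internal_before r p"
proof -
  have "internal_positions (Node l x r) \<inter> visited_before (Node l x r) (RightEdge # p) =
      (#) LeftEdge ` internal_positions l \<union>
      (#) RightEdge ` (internal_positions r \<inter> visited_before r p)"
    using assms by (auto simp: visited_before_RightEdge)
  then show ?thesis unfolding internal_before_def
    by (simp add: card_image card_Un_disjoint)
qed

text \<open>The summand 1 is the kept leaf, which opens the postorder and so precedes every other
  leaf.\<close>

lemma card_targets:
  assumes "p \<in> leaf_positions t - {kept_leaf t}"
  shows "card (tree_nodes t \<inter> visited_before t p) = 1 + internal_before t p"
proof -
  have "tree_nodes t \<inter> visited_before t p =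
      insert (kept_leaf t) (internal_positions t \<inter> visited_before t p)"
    using assms kept_leaf_visited_before[of p t] by (auto simp: tree_nodes_def)
  then show ?thesis
    using leaf_not_internal[OF kept_leaf_in, of t] by (simp add: internal_before_def)
qed

text \<open>
  The parameter \<open>c\<close> counts the nodes visited before the traversal enters the tree, so that
  every leaf contributes the number of its possible pointer targets. The kept leaf contributes
  the factor \<open>c\<close>, which is \<open>1\<close> for a whole tree.
\<close>

fun pointer_choices :: "nat \<Rightarrow> unit tree \<Rightarrow> nat" where
  "pointer_choices c Leaf = c"
| "pointer_choices c (Node l x r) = pointer_choices c l * pointer_choices (c + size l) r"

text \<open>The offset \<open>c\<close> must be arbitrary in the induction, since passing to the
  right subtree raises it by \<open>size l\<close>.\<close>

lemma prod_internal_before: "(\<Prod>p\<in>leaf_positions t. c + internal_before t p) = pointer_choices c t"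
proof (induction t arbitrary: c)
  case Leaf
  then show ?case by (simp add: internal_before_def)
next
  case (Node l x r)
  have "(\<Prod>p\<in>leaf_positions (Node l x r). c + internal_before (Node l x r) p) =
      (\<Prod>p\<in>leaf_positions l. c + internal_before (Node l x r) (LeftEdge # p)) *
      (\<Prod>p\<in>leaf_positions r. c + internal_before (Node l x r) (RightEdge # p))"
    by (simp add: prod.union_disjoint prod.reindex)
  also have "\<dots> = (\<Prod>p\<in>leaf_positions l. c + internal_before l p) *
      (\<Prod>p\<in>leaf_positions r. (c + size l) + internal_before r p)"
    by (simp add: internal_before_LeftEdge internal_before_RightEdge add.assoc)
  finally show ?case using Node by simp
qed

text \<open>The fibre of \<open>relaxed_trees\<close> over the shape \<open>t\<close>.\<close>

definition pointer_maps :: "unit tree \<Rightarrow> (pos \<rightharpoonup> pos) set" where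
  "pointer_maps t = {ptr. dom ptr = leaf_positions t - {kept_leaf t} \<and>
     (\<forall>p q. ptr p = Some q \<longrightarrow> q \<in> tree_nodes t \<inter> visited_before t p)}"

lemma pointer_maps_card: "finite (pointer_maps t) \<and> card (pointer_maps t) = pointer_choices 1 t"
proof -
  have "finite (pointer_maps t) \<and> card (pointer_maps t) =
      (\<Prod>p\<in>leaf_positions t - {kept_leaf t}. card (tree_nodes t \<inter> visited_before t p))"
    unfolding pointer_maps_def by (intro card_maps_dom) (auto simp: visited_before_def)
  also have "(\<Prod>p\<in>leaf_positions t - {kept_leaf t}. card (tree_nodes t \<inter> visited_before t p)) =
      (\<Prod>p\<in>leaf_positions t - {kept_leaf t}. 1 + internal_before t p)"
    by (intro prod.cong refl card_targets)
  also have "\<dots> = (\<Prod>p\<in>leaf_positions t. 1 + internal_before t p)"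
    \<comment> \<open>Including the kept leaf multiplies by 1 + 0, as nothing is visited before
      it.\<close>
    by (subst prod.remove[of "leaf_positions t" "kept_leaf t"])
      (auto simp: internal_before_def visited_before_kept_leaf)
  finally show ?thesis by (simp only: prod_internal_before)
qed

section \<open>Levels in inorder and right height\<close>

text \<open>Levels of the internal nodes in inorder. The kept leaf is omitted, so the node of index
  \<open>k\<close> has its level at position \<open>k - 1\<close>.\<close>

fun level_word :: "unit tree \<Rightarrow> nat list" where
  "level_word Leaf = []"
| "level_word (Node l x r) = level_word l @ 0 # map Suc (level_word r)"

lemma length_level_word [simp]: "length (level_word t) = size t"
  by (induction t) auto

lemma level_word_internal:
  "map level (filter (\<lambda>p. p \<in> internal_positions t) (inorder_positions t)) = level_word t"
proof (induction t)
  case (Node l x r)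
  show ?case by (auto simp: filter_map comp_def image_iff simp flip: Node)
qed simp

lemma set_level_word: "set (level_word t) = level ` internal_positions t"
  by (induction t) (auto simp: image_Un image_image)

lemma level_inorder_nodes: "map level (inorder_nodes (t, ptr)) = 0 # level_word t"
proof -
  have "map level (filter (\<lambda>p. p \<in> tree_nodes t) (inorder_positions t)) = 0 # level_word t"
  proof (induction t)
    case Leaf
    then show ?case by (simp add: tree_nodes_def)
  next
    case (Node l x r)
    \<comment> \<open>The kept leaf lies in the left subtree, so only internal positions survive on
      the right.\<close>
    have "filter (\<lambda>p. p \<in> tree_nodes (Node l x r)) (inorder_positions (Node l x r)) =
        map ((#) LeftEdge) (filter (\<lambda>p. p \<in> tree_nodes l) (inorder_positions l)) @ [] #
        map ((#) RightEdge) (filter (\<lambda>p. p \<in> internal_positions r) (inorder_positions r))"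
      by (auto simp: filter_map comp_def tree_nodes_def image_iff intro!: filter_cong)
    then have "map level (filter (\<lambda>p. p \<in> tree_nodes (Node l x r)) (inorder_positions (Node l x r))) =
        map level (filter (\<lambda>p. p \<in> tree_nodes l) (inorder_positions l)) @ 0 #
        map Suc (map level (filter (\<lambda>p. p \<in> internal_positions r) (inorder_positions r)))"
      by (simp add: comp_def)
    then show ?case by (simp only: Node.IH level_word_internal) simp
  qed
  then show ?thesis by (simp add: inorder_nodes_def)
qed

lemma level_inorder_nodes_nth:
  assumes "k \<in> {1..size t}"
  shows "level (inorder_nodes (t, ptr) ! k) = level_word t ! (k - 1)"
proof -
  have "length (inorder_nodes (t, ptr)) = Suc (size t)"
    using arg_cong[OF level_inorder_nodes, of length t ptr] by simp
  then have "level (inorder_nodes (t, ptr) ! k) = map level (inorder_nodes (t, ptr)) ! k"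
    using assms by simp
  then show ?thesis using assms by (simp add: level_inorder_nodes nth_Cons')
qed

text \<open>A longest node position extending \<open>p\<close> has no child, and extending a path
  never lowers its level.\<close>

lemma underlying_leaf_above:
  assumes "p \<in> tree_nodes t"
  shows "\<exists>q \<in> underlying_leaves (t, ptr). level p \<le> level q"
proof -
  let ?X = "{q \<in> tree_nodes t. \<exists>s. q = p @ s}"
  have fin: "finite (length ` ?X)" by (simp add: tree_nodes_def)
  moreover have "length ` ?X \<noteq> {}" using assms by auto
  ultimately have "Max (length ` ?X) \<in> length ` ?X" by (rule Max_in)
  then obtain q where q: "Max (length ` ?X) = length q" "q \<in> ?X" by (rule imageE)
  have max: "length q' \<le> length q" if "q' \<in> ?X" for q'
    unfolding q(1)[symmetric] using that fin by (intro Max_ge) auto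
  obtain s where s: "q = p @ s" using q by auto
  have "q @ [e] \<notin> tree_nodes t" for e
    using max[of "q @ [e]"] s by auto
  then have "q \<in> underlying_leaves (t, ptr)"
    using q by (simp add: underlying_leaves_def)
  moreover have "level p \<le> level q" by (simp add: s level_def)
  ultimately show ?thesis by blast
qed

text \<open>Bounding the levels of the leaves bounds those of all nodes, since each node has a leaf
  below it. The kept leaf, on level 0, imposes no condition.\<close>

lemma right_height_le_iff: "right_height (t, ptr) \<le> h \<longleftrightarrow> (\<forall>i \<in> set (level_word t). i \<le> h)"
proof -
  have fin: "finite (underlying_leaves (t, ptr))"
    by (simp add: underlying_leaves_def tree_nodes_def)
  have ne: "underlying_leaves (t, ptr) \<noteq> {}"
    using underlying_leaf_above[of "kept_leaf t" t] by (auto simp: tree_nodes_def)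
  have "right_height (t, ptr) \<le> h \<longleftrightarrow> (\<forall>q \<in> underlying_leaves (t, ptr). level q \<le> h)"
    unfolding right_height_def using fin ne by simp
  also have "\<dots> \<longleftrightarrow> (\<forall>q \<in> tree_nodes t. level q \<le> h)"
  proof
    show "\<forall>q \<in> tree_nodes t. level q \<le> h" if "\<forall>q \<in> underlying_leaves (t, ptr). level q \<le> h"
      using that underlying_leaf_above[of _ t ptr] order_trans by blast
  qed (auto simp: underlying_leaves_def)
  also have "\<dots> \<longleftrightarrow> (\<forall>i \<in> set (level_word t). i \<le> h)"
    by (auto simp: tree_nodes_def set_level_word)
  finally show ?thesis .
qed

section \<open>Shapes with a prescribed level word\<close>

text \<open>The last internal node in inorder ends the right spine; it is on level 0 only if the
  root itself ends that spine.\<close>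

lemma level_word_snoc_0:
  "{t. level_word t = w @ [0]} = (\<lambda>l. Node l () Leaf) ` {t. level_word t = w}"
proof (intro equalityI subsetI)
  fix t assume t: "t \<in> {t. level_word t = w @ [0]}"
  then obtain l r where lr: "t = Node l () r" by (cases t) auto
  have "r = Leaf"
  proof (rule ccontr)
    assume "r \<noteq> Leaf"
    then have "level_word r \<noteq> []" by (cases r) auto
    then have "last (level_word t) = Suc (last (level_word r))" by (simp add: lr last_map)
    then show False using t by simp
  qed
  then show "t \<in> (\<lambda>l. Node l () Leaf) ` {t. level_word t = w}" using t lr by auto
qed auto

text \<open>Here the right spine ends at the right child of the root. Removing that child and moving
  its left subtree up keeps all other levels, as left edges do not count. \<open>Leaf\<close> is
  excluded because it has no root to carry a right child.\<close>

lemma level_word_snoc_1: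
  "{t. level_word t = w @ [1]} =
    (\<lambda>t. Node (left t) () (Node (right t) () Leaf)) ` ({t. level_word t = w} - {Leaf})"
proof (intro equalityI subsetI)
  fix t assume t: "t \<in> {t. level_word t = w @ [1]}"
  then obtain l r where lr: "t = Node l () r" by (cases t) auto
  obtain l' r' where r: "r = Node l' () r'" using t lr by (cases r) auto
  have "r' = Leaf"
  proof (rule ccontr)
    assume "r' \<noteq> Leaf"
    then have "level_word r' \<noteq> []" by (cases r') auto
    then have "last (level_word t) = Suc (Suc (last (level_word r')))"
      by (simp add: lr r last_map)
    then show False using t by simp
  qed
  then have "t = Node l () (Node l' () Leaf)" "level_word (Node l () l') = w"
    using t by (auto simp: lr r)
  then show "t \<in> (\<lambda>t. Node (left t) () (Node (right t) () Leaf)) ` ({t. level_word t = w} - {Leaf})"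
    by (intro image_eqI[of _ _ "Node l () l'"]) auto
next
  fix t assume "t \<in> (\<lambda>t. Node (left t) () (Node (right t) () Leaf)) ` ({t. level_word t = w} - {Leaf})"
  then obtain t' where "t = Node (left t') () (Node (right t') () Leaf)"
    "level_word t' = w" "t' \<noteq> Leaf" by auto
  then show "t \<in> {t. level_word t = w @ [1]}" by (cases t') auto
qed

text \<open>The only level word with entries 0 and 1 whose zeros are at the indices, counted from 1,
  where \<open>b\<close> holds.\<close>

definition bit_word :: "(nat \<Rightarrow> bool) \<Rightarrow> nat \<Rightarrow> nat list" where
  "bit_word b n = map (\<lambda>k. if b k then 0 else 1) [1..<Suc n]"

lemma bit_word_Suc: "bit_word b (Suc n) = bit_word b n @ [if b (Suc n) then 0 else 1]"
  by (simp add: bit_word_def)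

text \<open>At most one shape occurs, and none if \<open>n > 0\<close> and \<open>b 1\<close> fails.
  Summing treats both cases at once: the factor \<open>k - 1\<close> vanishes at
  \<open>k = 1\<close>.\<close>

lemma sum_pointer_choices:
  "finite {t. level_word t = bit_word b n} \<and>
    (\<Sum>t | level_word t = bit_word b n. pointer_choices 1 t) = (\<Prod>k=1..n. if b k then k else k - 1)"
proof (induction n)
  case 0
  have "{t. level_word t = bit_word b 0} = {Leaf}"
    by (auto simp: bit_word_def elim: level_word.elims)
  then show ?case by simp
next
  case (Suc n)
  let ?S = "{t. level_word t = bit_word b n}"
  have size: "size t = n" if "t \<in> ?S" for t
    using that length_level_word[of t] by (simp add: bit_word_def del: upt_Suc length_level_word)
  show ?case
  proof (cases "b (Suc n)")
    case True
    have S: "{t. level_word t = bit_word b (Suc n)} = (\<lambda>l. Node l () Leaf) ` ?S"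
      using True by (simp add: bit_word_Suc level_word_snoc_0)
    \<comment> \<open>The pointer to the right of the new root may target all \<open>n\<close>
      internal nodes of \<open>l\<close> and the kept leaf.\<close>
    have "(\<Sum>t\<in>(\<lambda>l. Node l () Leaf) ` ?S. pointer_choices 1 t) =
        (\<Sum>t\<in>?S. pointer_choices 1 t * (Suc n))"
      by (subst sum.reindex) (auto simp: inj_on_def size)
    then show ?thesis using Suc True S by (simp del: mult_Suc_right flip: sum_distrib_right)
  next
    case False
    let ?f = "\<lambda>t. Node (left t) () (Node (right t) () Leaf)"
    have S: "{t. level_word t = bit_word b (Suc n)} = ?f ` (?S - {Leaf})"
      using False by (simp add: bit_word_Suc flip: level_word_snoc_1)
    have inj: "inj_on ?f (?S - {Leaf})"
    proof (rule inj_onI)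
      fix t u assume "t \<in> ?S - {Leaf}" "u \<in> ?S - {Leaf}" "?f t = ?f u"
      then show "t = u" by (cases t; cases u) auto
    qed
    \<comment> \<open>The new pointer may target the \<open>n - 1\<close> internal nodes of
      \<open>t\<close> other than its root, and the kept leaf.\<close>
    have "(\<Sum>t\<in>?f ` (?S - {Leaf}). pointer_choices 1 t) =
        (\<Sum>t\<in>?S - {Leaf}. pointer_choices 1 t * n)"
    proof (subst sum.reindex[OF inj], rule sum.cong)
      fix t assume t: "t \<in> ?S - {Leaf}"
      then obtain l r where "t = Node l () r" by (cases t) auto
      then show "(pointer_choices 1 \<circ> ?f) t = pointer_choices 1 t * n"
        using size[of t] t by auto
    qed simp
    \<comment> \<open>\<open>Leaf\<close> belongs to \<open>?S\<close> only for
      \<open>n = 0\<close>, and then the factor \<open>n\<close> kills its term.\<close>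
    also have "\<dots> = (\<Sum>t\<in>?S. pointer_choices 1 t * n)"
    proof (rule sum.mono_neutral_left)
      show "\<forall>t \<in> ?S - (?S - {Leaf}). pointer_choices 1 t * n = 0"
        using size[of Leaf] by auto
    qed (use Suc in auto)
    finally show ?thesis using Suc False S by (simp flip: sum_distrib_right)
  qed
qed

text \<open>With levels at most 1, prescribing the nodes on level 0 prescribes the whole level word;
  the pointer map is then free for each shape.\<close>

lemma relaxed_fibre:
  "finite {R \<in> relaxed_trees n. right_height R \<le> 1 \<and>
      (\<forall>k \<in> {1..n}. level (inorder_nodes R ! k) = 0 \<longleftrightarrow> b k)} \<and>
   card {R \<in> relaxed_trees n. right_height R \<le> 1 \<and>
      (\<forall>k \<in> {1..n}. level (inorder_nodes R ! k) = 0 \<longleftrightarrow> b k)} = (\<Prod>k=1..n. if b k then k else k - 1)"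
  (is "finite ?A \<and> card ?A = ?c")
proof -
  have "?A = Sigma {t. level_word t = bit_word b n} pointer_maps"
  proof (intro set_eqI)
    fix R :: relaxed_tree
    obtain t ptr where R: "R = (t, ptr)" by (cases R)
    have "R \<in> ?A \<longleftrightarrow> ptr \<in> pointer_maps t \<and> size t = n \<and> (\<forall>i \<in> set (level_word t). i \<le> 1) \<and>
        (\<forall>k \<in> {1..n}. level_word t ! (k - 1) = 0 \<longleftrightarrow> b k)"
      using level_inorder_nodes_nth[of _ t ptr]
      by (auto simp: R relaxed_trees_def pointer_maps_def right_height_le_iff)
    also have "size t = n \<and> (\<forall>i \<in> set (level_word t). i \<le> 1) \<and>
        (\<forall>k \<in> {1..n}. level_word t ! (k - 1) = 0 \<longleftrightarrow> b k) \<longleftrightarrow>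
      size t = n \<and> (\<forall>i<n. level_word t ! i \<le> 1 \<and> (level_word t ! i = 0 \<longleftrightarrow> b (Suc i)))"
    proof -
      have "(\<forall>k \<in> {1..n}. level_word t ! (k - 1) = 0 \<longleftrightarrow> b k) \<longleftrightarrow>
          (\<forall>i<n. level_word t ! i = 0 \<longleftrightarrow> b (Suc i))"
        unfolding image_Suc_lessThan[symmetric] by auto
      then show ?thesis by (auto simp: all_set_conv_all_nth)
    qed
    also have "\<dots> \<longleftrightarrow> level_word t = bit_word b n"
    proof -
      have "length (bit_word b n) = n" by (simp add: bit_word_def)
      moreover have "bit_word b n ! i = (if b (Suc i) then 0 else 1)" if "i < n" for i
        using that by (simp add: bit_word_def del: upt_Suc)
      ultimately show ?thesis
        unfolding list_eq_iff_nth_eq by (auto simp: le_Suc_eq split: if_splits)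
    qed
    finally show "R \<in> ?A \<longleftrightarrow> R \<in> Sigma {t. level_word t = bit_word b n} pointer_maps"
      by (auto simp: R)
  qed
  then show ?thesis
    using sum_pointer_choices[of b n] pointer_maps_card by simp
qed

section \<open>Growing plane increasing trees\<close>

text \<open>
  The flag decides whether the new leaf \<open>x\<close> becomes a first child or is put immediately to the right
  of an existing node.
\<close>

fun grow :: "bool \<Rightarrow> nat \<Rightarrow> plane_tree \<Rightarrow> plane_tree list"
  and grow_forest :: "bool \<Rightarrow> nat \<Rightarrow> plane_tree list \<Rightarrow> plane_tree list list" where
  "grow b x (PNode a ts) =
     (if b then [PNode a (PNode x [] # ts)] else []) @ map (PNode a) (grow_forest b x ts)"
| "grow_forest b x [] = []"
| "grow_forest b x (t # ts) =
     (if b then [] else [t # PNode x [] # ts]) @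
     map (\<lambda>t'. t' # ts) (grow b x t) @ map ((#) t) (grow_forest b x ts)"

section \<open>Insertion places and their distinctness\<close>

lemma length_labels_pos [simp]: "labels t \<noteq> []"
  by (cases t) auto

lemma root_label_in_labels [simp]: "root_label t \<in> set (labels t)"
  by (cases t) auto

text \<open>In a forest every node offers one place for either flag, below it or to its right. In a
  single tree the root offers no place to its right.\<close>

lemma length_grow:
  "length (grow b x t) = (if b then length (labels t) else length (labels t) - 1)"
  "length (grow_forest b x ts) = length (concat (map labels ts))"
proof (induction b x t and b x ts rule: grow_grow_forest.induct)
  case (3 b x t ts)
  have "0 < length (labels t)" by simp
  then show ?case using 3 by (auto simp del: length_greater_0_conv length_labels_pos)
qed auto

lemma root_label_grow: "t' \<in> set (grow b x t) \<Longrightarrow> root_label t' = root_label t"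
  by (cases t) (auto split: if_splits)

text \<open>\<open>grow_forest\<close> never inserts in front of the first tree; only the parent
  does so in \<open>grow\<close>, with flag \<open>True\<close>. The two kinds of insertion
  therefore never coincide.\<close>

lemma hd_grow_forest:
  "ts' \<in> set (grow_forest b x ts) \<Longrightarrow>
    ts \<noteq> [] \<and> ts' \<noteq> [] \<and> root_label (hd ts') = root_label (hd ts)"
  by (cases ts) (auto split: if_splits dest: root_label_grow)

lemma mset_labels_grow:
  "t' \<in> set (grow b x t) \<Longrightarrow> mset (labels t') = add_mset x (mset (labels t))"
  "ts' \<in> set (grow_forest b x ts) \<Longrightarrow>
    mset (concat (map labels ts')) = add_mset x (mset (concat (map labels ts)))"
  by (induction b x t and b x ts arbitrary: t' and ts' rule: grow_grow_forest.induct)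
    (force split: if_splits)+

lemma grow_neq: "t \<notin> set (grow b x t)"
  using mset_labels_grow(1)[of t b x t] by auto

text \<open>If two places gave the same result, either \<open>ts\<close> would begin with a root
  labelled \<open>x\<close>, or growing \<open>t\<close> would return \<open>t\<close> itself;
  freshness of \<open>x\<close> and the label count exclude this.\<close>

lemma distinct_grow:
  "x \<notin> set (labels t) \<Longrightarrow> distinct (grow b x t)"
  "x \<notin> set (concat (map labels ts)) \<Longrightarrow> distinct (grow_forest b x ts)"
proof (induction b x t and b x ts rule: grow_grow_forest.induct)
  case (1 b x a ts)
  have "PNode x [] # ts \<notin> set (grow_forest b x ts)"
    using hd_grow_forest[of "PNode x [] # ts" b x ts] 1(2) root_label_in_labels
    by (cases ts) auto
  then show ?case using 1 by (auto simp: distinct_map inj_on_def)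
next
  case (3 b x t ts)
  have "PNode x [] # ts \<notin> set (grow_forest b x ts)"
    using hd_grow_forest[of "PNode x [] # ts" b x ts] 3(3) root_label_in_labels
    by (cases ts) auto
  then show ?case using 3 grow_neq[of t b x] by (auto simp: distinct_map inj_on_def)
qed auto

section \<open>Restriction and monotonicity under growth\<close>

lemma root_label_restrict [simp]: "root_label (restrict_tree k t) = root_label t"
  by (cases t) auto

definition restrict_forest :: "nat \<Rightarrow> plane_tree list \<Rightarrow> plane_tree list" where
  "restrict_forest k ts = filter (\<lambda>t. root_label t \<le> k) (map (restrict_tree k) ts)"

lemma restrict_forest_simps [simp]:
  "restrict_forest k [] = []"
  "restrict_forest k (t # ts) =
    (if root_label t \<le> k then [restrict_tree k t] else []) @ restrict_forest k ts"
  by (auto simp: restrict_forest_def)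

lemma restrict_tree_PNode [simp]: "restrict_tree k (PNode a ts) = PNode a (restrict_forest k ts)"
  by (simp add: restrict_forest_def)

declare restrict_tree.simps [simp del]

lemma restrict_forest_id:
  "(\<And>t. t \<in> set ts \<Longrightarrow> root_label t \<le> k \<and> restrict_tree k t = t) \<Longrightarrow> restrict_forest k ts = ts"
  by (induction ts) auto

lemma restrict_tree_id: "\<forall>a \<in> set (labels t). a \<le> k \<Longrightarrow> restrict_tree k t = t"
proof (induction t)
  case (PNode a ts)
  have "restrict_forest k ts = ts"
  proof (rule restrict_forest_id)
    fix t assume t: "t \<in> set ts"
    then have "\<forall>a \<in> set (labels t). a \<le> k" using PNode.prems by auto
    then show "root_label t \<le> k \<and> restrict_tree k t = t"
      using PNode.IH[OF t] root_label_in_labels by blast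
  qed
  then show ?case by simp
qed

text \<open>The new leaf exceeds \<open>k\<close> and is cut off again. Hence growth can be undone
  and leaves all earlier restrictions unchanged.\<close>

lemma restrict_grow:
  "t' \<in> set (grow b x t) \<Longrightarrow> k < x \<Longrightarrow> restrict_tree k t' = restrict_tree k t"
  "ts' \<in> set (grow_forest b x ts) \<Longrightarrow> k < x \<Longrightarrow> restrict_forest k ts' = restrict_forest k ts"
proof (induction b x t and b x ts arbitrary: t' and ts' rule: grow_grow_forest.induct)
  case (3 b x t ts)
  have "root_label t' = root_label t" if "t' \<in> set (grow b x t)" for t'
    using that by (rule root_label_grow)
  then show ?case using 3 by (cases b) auto
qed (auto split: if_splits)

lemma increasing_PNode [simp]:
  "increasing (PNode a ts) \<longleftrightarrow> (\<forall>t \<in> set ts. a < root_label t \<and> increasing t)"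
  by (auto simp: increasing_def)

text \<open>The new node has no children, so the only new condition compares it with its parent, and
  it exceeds every old label. In the forest part \<open>c\<close> stands for the parent's
  label.\<close>

lemma increasing_grow:
  "t' \<in> set (grow b x t) \<Longrightarrow> \<forall>a \<in> set (labels t). a < x \<Longrightarrow> increasing t' \<longleftrightarrow> increasing t"
  "ts' \<in> set (grow_forest b x ts) \<Longrightarrow> \<forall>a \<in> set (concat (map labels ts)). a < x \<Longrightarrow> c < x \<Longrightarrow>
    (\<forall>t \<in> set ts'. c < root_label t \<and> increasing t) \<longleftrightarrow>
    (\<forall>t \<in> set ts. c < root_label t \<and> increasing t)"
proof (induction b x t and b x ts arbitrary: t' and ts' c rule: grow_grow_forest.induct)
  case (1 b x a ts)
  from 1(2) consider "b" "t' = PNode a (PNode x [] # ts)"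
    | ts' where "ts' \<in> set (grow_forest b x ts)" "t' = PNode a ts'"
    by (auto split: if_splits)
  then show ?case
  proof cases
    case 1
    then show ?thesis using \<open>\<forall>a \<in> _. _\<close> by simp
  next
    case 2
    then show ?thesis using 1(1)[OF 2(1), of a] 1(3) by simp
  qed
next
  case (3 b x t ts)
  from 3(3) consider "\<not> b" "ts' = t # PNode x [] # ts"
    | t' where "t' \<in> set (grow b x t)" "ts' = t' # ts"
    | us where "us \<in> set (grow_forest b x ts)" "ts' = t # us"
    by (auto split: if_splits)
  then show ?case
  proof cases
    case 1
    then show ?thesis using 3(5) by auto
  next
    case 2
    then show ?thesis using 3(1)[OF 2(1)] 3(4) root_label_grow[OF 2(1)] by auto
  next
    case 3
    then show ?thesis using "3.IH"(2)[OF 3(1)] "3.prems" by auto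
  qed
qed auto

section \<open>Young leaves under growth\<close>

lemma has_left_sibling_PNode [simp]:
  "has_left_sibling (PNode a ts) x \<longleftrightarrow>
    x \<in> root_label ` set (tl ts) \<or> (\<exists>t \<in> set ts. has_left_sibling t x)"
proof -
  have "(\<exists>i j. i < j \<and> j < length ts \<and> root_label (ts ! j) = x) \<longleftrightarrow> x \<in> root_label ` set (tl ts)"
  proof
    assume "\<exists>i j. i < j \<and> j < length ts \<and> root_label (ts ! j) = x"
    then obtain j where "0 < j" "j < length ts" "root_label (ts ! j) = x"
      by (metis less_nat_zero_code neq0_conv)
    then have "j - 1 < length (tl ts)" "root_label (tl ts ! (j - 1)) = x"
      by (auto simp: nth_tl)
    then show "x \<in> root_label ` set (tl ts)" by (metis imageI nth_mem)
  next
    assume "x \<in> root_label ` set (tl ts)"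
    then obtain j where "j < length (tl ts)" "root_label (tl ts ! j) = x"
      by (auto simp: in_set_conv_nth)
    then have "0 < Suc j \<and> Suc j < length ts \<and> root_label (ts ! Suc j) = x"
      by (auto simp: nth_tl)
    then show "\<exists>i j. i < j \<and> j < length ts \<and> root_label (ts ! j) = x" by blast
  qed
  then show ?thesis by (auto simp: has_left_sibling_def)
qed

lemma is_leaf_PNode [simp]:
  "is_leaf (PNode a ts) x \<longleftrightarrow> (a = x \<and> ts = []) \<or> (\<exists>t \<in> set ts. is_leaf t x)"
  by (auto simp: is_leaf_def)

lemma is_leaf_in_labels: "is_leaf t x \<Longrightarrow> x \<in> set (labels t)"
  by (induction t) auto

lemma has_left_sibling_in_labels: "has_left_sibling t x \<Longrightarrow> x \<in> set (labels t)"
proof (induction t)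
  case (PNode a ts)
  then consider u where "u \<in> set (tl ts)" "x = root_label u"
    | u where "u \<in> set ts" "has_left_sibling u x" by auto
  then obtain u where "u \<in> set ts" "x \<in> set (labels u)"
  proof cases
    case (1 u)
    then show ?thesis using that[of u] by (cases ts) auto
  next
    case (2 u)
    then show ?thesis using that[of u] PNode.IH by auto
  qed
  then show ?case by auto
qed

lemma is_leaf_grow:
  "t' \<in> set (grow b x t) \<Longrightarrow> is_leaf t' x"
  "ts' \<in> set (grow_forest b x ts) \<Longrightarrow> \<exists>t \<in> set ts'. is_leaf t x"
  by (induction b x t and b x ts arbitrary: t' and ts' rule: grow_grow_forest.induct)
    (force split: if_splits)+

text \<open>As \<open>x\<close> is fresh, its only occurrence is the inserted leaf, whose place is a
  first child or to the right of a node according to \<open>b\<close>. The forest part has the form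
  of the condition at a parent node.\<close>

lemma has_left_sibling_grow:
  "t' \<in> set (grow b x t) \<Longrightarrow> x \<notin> set (labels t) \<Longrightarrow> has_left_sibling t' x \<longleftrightarrow> \<not> b"
  "ts' \<in> set (grow_forest b x ts) \<Longrightarrow> x \<notin> set (concat (map labels ts)) \<Longrightarrow>
    x \<in> root_label ` set (tl ts') \<or> (\<exists>t \<in> set ts'. has_left_sibling t x) \<longleftrightarrow> \<not> b"
proof (induction b x t and b x ts arbitrary: t' and ts' rule: grow_grow_forest.induct)
  case (1 b x a ts)
  have ts: "x \<notin> root_label ` set ts" "\<forall>t \<in> set ts. \<not> has_left_sibling t x"
    using 1(3) has_left_sibling_in_labels[of _ x] root_label_in_labels by fastforce+
  from 1(2) consider "b" "t' = PNode a (PNode x [] # ts)"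
    | ts' where "ts' \<in> set (grow_forest b x ts)" "t' = PNode a ts'"
    by (auto split: if_splits)
  then show ?case
  proof cases
    case 1
    then show ?thesis using ts by simp
  next
    case 2
    then show ?thesis using "1.IH"[OF 2(1)] "1.prems"(2) by simp
  qed
next
  case (3 b x t ts)
  have ts: "x \<noteq> root_label u" "\<not> has_left_sibling u x" if "u \<in> set (t # ts)" for u
    using 3(4) that has_left_sibling_in_labels[of u x] root_label_in_labels[of u] by auto
  from 3(3) consider "\<not> b" "ts' = t # PNode x [] # ts"
    | t' where "t' \<in> set (grow b x t)" "ts' = t' # ts"
    | us where "us \<in> set (grow_forest b x ts)" "ts' = t # us"
    by (auto split: if_splits)
  then show ?case
  proof cases
    case 1
    then show ?thesis by simp
  next
    case 2
    then show ?thesis using "3.IH"(1)[OF 2(1)] "3.prems"(2) ts by auto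
  next
    case 3
    \<comment> \<open>Behind \<open>t\<close> all of \<open>us\<close> has a left sibling, but the
      induction hypothesis speaks of \<open>tl us\<close>; the head of \<open>us\<close> is an old
      root, so the difference is harmless.\<close>
    have us: "us \<noteq> []" "root_label (hd us) \<noteq> x"
      using hd_grow_forest[OF 3(1)] ts(1)[of "hd ts"] by auto
    then have "x \<in> root_label ` set us \<longleftrightarrow> x \<in> root_label ` set (tl us)" by (cases us) auto
    then show ?thesis using "3.IH"(2)[OF 3(1)] "3.prems"(2) ts 3(2) by auto
  qed
qed auto

text \<open>The new leaf has the largest label, so it is a maximal young leaf as soon as it is
  young.\<close>

lemma maximal_young_leaf_grow:
  assumes "t' \<in> set (grow b x t)" "\<forall>a \<in> set (labels t). a < x"
  shows "maximal_young_leaf t' x \<longleftrightarrow> b"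
proof -
  have "set (labels t') = insert x (set (labels t))"
    using arg_cong[OF mset_labels_grow(1)[OF assms(1)], of set_mset] by simp
  then have "a \<le> x" if "young_leaf t' a" for a
    using that assms(2) is_leaf_in_labels[of t' a] by (auto simp: young_leaf_def)
  moreover have "x \<notin> set (labels t)" using assms(2) by auto
  ultimately show ?thesis
    using is_leaf_grow(1)[OF assms(1)] has_left_sibling_grow(1)[OF assms(1)]
    by (auto simp: maximal_young_leaf_def young_leaf_def)
qed

section \<open>Inverting growth\<close>

text \<open>By distinctness exactly one tree contains \<open>x\<close>, and restriction fixes the
  others. The first alternative, \<open>x\<close> at the front, is left for the parent to
  produce.\<close>

lemma forest_in_grow:
  assumes "\<And>t. t \<in> set ts \<Longrightarrow> x \<in> set (labels t) \<Longrightarrow> root_label t \<noteq> x \<Longrightarrow>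
      root_label t \<le> k \<and> (\<exists>b. t \<in> set (grow b x (restrict_tree k t)))"
    and "\<And>t. t \<in> set ts \<Longrightarrow> root_label t = x \<Longrightarrow> t = PNode x []"
    and "\<And>t. t \<in> set ts \<Longrightarrow> x \<notin> set (labels t) \<Longrightarrow> root_label t \<le> k \<and> restrict_tree k t = t"
    and "distinct (concat (map labels ts))" "x \<in> set (concat (map labels ts))" "k < x"
  shows "ts = PNode x [] # restrict_forest k ts \<or>
    (\<exists>b. ts \<in> set (grow_forest b x (restrict_forest k ts)))"
  using assms
proof (induction ts)
  case (Cons t ts)
  show ?case
  proof (cases "x \<in> set (labels t)")
    case True
    then have "x \<notin> set (labels u)" if "u \<in> set ts" for u
      using Cons.prems(4) that by auto
    then have ts: "restrict_forest k ts = ts"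
      using Cons.prems(3) by (intro restrict_forest_id) auto
    show ?thesis
    proof (cases "root_label t = x")
      case True
      then show ?thesis using Cons.prems(2)[of t] Cons.prems(6) ts by simp
    next
      case False
      then obtain b where "root_label t \<le> k" "t \<in> set (grow b x (restrict_tree k t))"
        using Cons.prems(1)[of t] \<open>x \<in> set (labels t)\<close> by auto
      then show ?thesis using ts by (auto intro!: exI[of _ b])
    qed
  next
    case False
    then have t: "root_label t \<le> k" "restrict_tree k t = t" using Cons.prems(3)[of t] by auto
    have "ts = PNode x [] # restrict_forest k ts \<or>
        (\<exists>b. ts \<in> set (grow_forest b x (restrict_forest k ts)))"
      using Cons.prems False by (intro Cons.IH) auto
    then show ?thesis
    proof (elim disjE exE)
      \<comment> \<open>At the front of the tail, \<open>x\<close> stands immediately to the right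
        of \<open>t\<close>, which calls for the flag \<open>False\<close>.\<close>
      assume "ts = PNode x [] # restrict_forest k ts"
      then have "t # ts \<in> set (grow_forest False x (restrict_forest k (t # ts)))"
        using t by simp
      then show ?thesis by blast
    next
      fix b assume "ts \<in> set (grow_forest b x (restrict_forest k ts))"
      then show ?thesis using t by (auto intro!: exI[of _ b])
    qed
  qed
qed simp

text \<open>Since \<open>x\<close> exceeds all other labels it sits at a leaf, and restricting to
  \<open>k\<close> removes just this leaf.\<close>

lemma tree_in_grow:
  assumes "increasing t" "distinct (labels t)" "x \<in> set (labels t)" "root_label t \<noteq> x"
    "\<forall>a \<in> set (labels t). a \<le> k \<or> a = x" "k < x"
  shows "\<exists>b. t \<in> set (grow b x (restrict_tree k t))"
  using assms
proof (induction t)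
  case (PNode a ts)
  have "ts = PNode x [] # restrict_forest k ts \<or>
      (\<exists>b. ts \<in> set (grow_forest b x (restrict_forest k ts)))"
  proof (rule forest_in_grow)
    fix t assume t: "t \<in> set ts"
    have bnd: "\<forall>a \<in> set (labels t). a \<le> k \<or> a = x" using t PNode.prems(5) by auto
    have dist: "distinct (labels t)" using t PNode.prems(2) by (auto simp: distinct_concat_iff)
    show "root_label t \<le> k \<and> (\<exists>b. t \<in> set (grow b x (restrict_tree k t)))"
      if "x \<in> set (labels t)" "root_label t \<noteq> x"
      using PNode.IH[OF t _ dist that bnd] PNode.prems(1,6) t bnd that(2) root_label_in_labels[of t]
      by auto
    show "t = PNode x []" if "root_label t = x"
    proof -
      obtain c us where tc: "t = PNode c us" by (cases t)
      \<comment> \<open>A child of \<open>x\<close> would carry a label above \<open>x\<close>,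
        while all other labels are at most \<open>k\<close>.\<close>
      have "us = []"
      proof (rule ccontr)
        assume "us \<noteq> []"
        then obtain u where u: "u \<in> set us" by (cases us) auto
        then have "root_label u \<in> set (labels t)"
          using tc by (auto intro: bexI[of _ u])
        moreover have "x < root_label u"
          using u tc PNode.prems(1) t that by auto
        ultimately show False using bnd \<open>k < x\<close> by auto
      qed
      then show ?thesis using that tc by simp
    qed
    show "root_label t \<le> k \<and> restrict_tree k t = t" if "x \<notin> set (labels t)"
    proof -
      have "\<forall>a \<in> set (labels t). a \<le> k" using bnd that by auto
      then show ?thesis using restrict_tree_id root_label_in_labels by blast
    qed
  qed (use PNode.prems in auto)
  then show ?case
  proof (elim disjE exE)
    assume "ts = PNode x [] # restrict_forest k ts"
    then have "PNode a ts \<in> set (grow True x (restrict_tree k (PNode a ts)))" by simp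
    then show ?thesis by blast
  next
    fix b assume "ts \<in> set (grow_forest b x (restrict_forest k ts))"
    then show ?thesis by (auto intro!: exI[of _ b])
  qed
qed

section \<open>Counting increasing trees\<close>

lemma root_label_plane_increasing:
  assumes "t \<in> plane_increasing_trees n"
  shows "root_label t = 0"
proof -
  have least: "root_label t \<le> a" if "increasing t" "a \<in> set (labels t)" for t a
    using that by (induction t) fastforce
  show ?thesis using assms least[of t 0] by (auto simp: plane_increasing_trees_def)
qed

lemma grow_plane_increasing:
  assumes "t' \<in> set (grow b (Suc n) t)"
  shows "t' \<in> plane_increasing_trees (Suc n) \<longleftrightarrow> t \<in> plane_increasing_trees n"
proof -
  have ms: "mset (labels t') = mset (Suc n # labels t)"
    using mset_labels_grow(1)[OF assms] by simp
  have set: "set (labels t') = insert (Suc n) (set (labels t))"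
    using arg_cong[OF ms, of set_mset] by simp
  have dist: "distinct (labels t') \<longleftrightarrow> Suc n \<notin> set (labels t) \<and> distinct (labels t)"
    using mset_eq_imp_distinct_iff[OF ms] by simp
  \<comment> \<open>Freshness, which distinctness of the grown labels provides, allows
    \<open>Suc n\<close> to be cancelled on both sides.\<close>
  have "Suc n \<notin> set (labels t) \<and> set (labels t') = {0..Suc n} \<longleftrightarrow> set (labels t) = {0..n}"
    using insert_ident[of "Suc n" "set (labels t)" "{0..n}"]
    unfolding set atLeast0_atMost_Suc by auto
  moreover have "increasing t' \<longleftrightarrow> increasing t" if "set (labels t) = {0..n}"
    using increasing_grow(1)[OF assms] that by auto
  ultimately show ?thesis
    unfolding plane_increasing_trees_def using dist by auto
qed

text \<open>The fibre for \<open>Suc n\<close> is the disjoint union, over the trees in the fibre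
  for \<open>n\<close>, of their growths with the prescribed flag.\<close>

lemma plane_increasing_fibre:
  "finite {T \<in> plane_increasing_trees n.
      \<forall>k \<in> {1..n}. maximal_young_leaf (restrict_tree k T) k \<longleftrightarrow> b k} \<and>
   card {T \<in> plane_increasing_trees n.
      \<forall>k \<in> {1..n}. maximal_young_leaf (restrict_tree k T) k \<longleftrightarrow> b k} =
   (\<Prod>k=1..n. if b k then k else k - 1)"
proof (induction n)
  case 0
  have "plane_increasing_trees 0 = {PNode 0 []}"
  proof (intro equalityI subsetI)
    fix t assume t: "t \<in> plane_increasing_trees 0"
    then have "length (labels t) = 1"
      using distinct_card[of "labels t"] by (simp add: plane_increasing_trees_def)
    then show "t \<in> {PNode 0 []}" using root_label_plane_increasing[OF t]
      by (cases t; cases "children t") auto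
  qed (simp add: plane_increasing_trees_def)
  then show ?case by simp
next
  case (Suc n)
  define B where "B m = {T \<in> plane_increasing_trees m.
      \<forall>k \<in> {1..m}. maximal_young_leaf (restrict_tree k T) k \<longleftrightarrow> b k}" for m
  let ?g = "\<lambda>T. set (grow (b (Suc n)) (Suc n) T)"
  have labels: "set (labels T) = {0..m}" if "T \<in> plane_increasing_trees m" for T m
    using that by (simp add: plane_increasing_trees_def)
  have restrict_id: "restrict_tree m T = T" if "T \<in> plane_increasing_trees m" for T m
    using labels[OF that] by (simp add: restrict_tree_id)
  have B_iff: "T' \<in> B (Suc n) \<longleftrightarrow> T \<in> B n \<and> c = b (Suc n)"
    if T': "T' \<in> set (grow c (Suc n) T)" for T T' c
  proof (cases "T \<in> plane_increasing_trees n")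
    case True
    then have "T' \<in> plane_increasing_trees (Suc n)" using grow_plane_increasing[OF T'] by simp
    moreover have "maximal_young_leaf (restrict_tree (Suc n) T') (Suc n) \<longleftrightarrow> c"
      using maximal_young_leaf_grow[OF T'] labels[OF True] restrict_id[OF calculation] by auto
    moreover have "restrict_tree k T' = restrict_tree k T" if "k \<in> {1..n}" for k
      using restrict_grow(1)[OF T'] that by auto
    ultimately show ?thesis using True by (auto simp: B_def atLeastAtMostSuc_conv)
  next
    case False
    then show ?thesis using grow_plane_increasing[OF T'] by (simp add: B_def)
  qed
  have B_Suc: "B (Suc n) = (\<Union>T \<in> B n. ?g T)"
  proof (intro equalityI subsetI)
    fix T assume T: "T \<in> B (Suc n)"
    then have P: "T \<in> plane_increasing_trees (Suc n)" by (simp add: B_def)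
    \<comment> \<open>The root has label 0, so \<open>Suc n\<close> is not at the root and can be
      removed.\<close>
    have "\<exists>c. T \<in> set (grow c (Suc n) (restrict_tree n T))"
      by (rule tree_in_grow)
        (use P root_label_plane_increasing[OF P] in \<open>auto simp: plane_increasing_trees_def\<close>)
    then obtain c where c: "T \<in> set (grow c (Suc n) (restrict_tree n T))" ..
    then have "restrict_tree n T \<in> B n" "c = b (Suc n)" using B_iff[OF c] T by auto
    then show "T \<in> (\<Union>T \<in> B n. ?g T)" using c by auto
  next
    fix T' assume "T' \<in> (\<Union>T \<in> B n. ?g T)"
    then obtain T where "T \<in> B n" and T': "T' \<in> ?g T" by blast
    then show "T' \<in> B (Suc n)" using B_iff[OF T'] by simp
  qed
  \<comment> \<open>Restricting to \<open>n\<close> recovers the tree before growth.\<close>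
  have disj: "?g T \<inter> ?g U = {}" if "T \<in> B n" "U \<in> B n" "T \<noteq> U" for T U
  proof -
    have "restrict_tree n T' = V" if "T' \<in> ?g V" "V \<in> B n" for T' V
      using restrict_grow(1)[OF that(1), of n] restrict_id[of V n] that(2) by (simp add: B_def)
    then show ?thesis using that by blast
  qed
  have card_g: "card (?g T) = (if b (Suc n) then Suc n else n)" if "T \<in> B n" for T
  proof -
    have T: "distinct (labels T)" "set (labels T) = {0..n}"
      using that by (auto simp: B_def plane_increasing_trees_def)
    then have "length (labels T) = Suc n" using distinct_card[of "labels T"] by simp
    moreover have "distinct (grow (b (Suc n)) (Suc n) T)" using T by (intro distinct_grow) auto
    ultimately show ?thesis by (simp add: distinct_card length_grow)
  qed
  have IH: "finite (B n)" "card (B n) = (\<Prod>k=1..n. if b k then k else k - 1)"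
    using Suc by (auto simp: B_def)
  have "card (B (Suc n)) = (\<Sum>T\<in>B n. card (?g T))"
    unfolding B_Suc using IH(1) disj by (intro card_UN_disjoint) auto
  also have "\<dots> = card (B n) * (if b (Suc n) then Suc n else n)"
    by (simp add: card_g)
  finally have "finite (B (Suc n)) \<and>
      card (B (Suc n)) = (\<Prod>k=1..Suc n. if b k then k else k - 1)"
    using IH by (auto simp: B_Suc)
  then show ?case by (simp only: B_def)
qed

section \<open>Matching the fibres of the two statistics\<close>

theorem theorem1:
  fixes n :: nat
  shows "\<exists>\<Phi> :: relaxed_tree \<Rightarrow> plane_tree.
    bij_betw \<Phi> {\<R> \<in> relaxed_trees n. right_height \<R> \<le> 1} (plane_increasing_trees n) \<and>
    (\<forall>\<R> \<in> {\<R> \<in> relaxed_trees n. right_height \<R> \<le> 1}. \<forall>k \<in> {1..n}.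
       level (inorder_nodes \<R> ! k) = 0 \<longleftrightarrow>
       maximal_young_leaf (restrict_tree k (\<Phi> \<R>)) k)"
proof -
  let ?A = "{\<R> \<in> relaxed_trees n. right_height \<R> \<le> 1}"
  let ?B = "plane_increasing_trees n"
  \<comment> \<open>Index 0 is excluded, as it belongs to the kept leaf, which is always on level
    0.\<close>
  let ?f = "\<lambda>\<R>. {k \<in> {1..n}. level (inorder_nodes \<R> ! k) = 0}"
  let ?g = "\<lambda>T. {k \<in> {1..n}. maximal_young_leaf (restrict_tree k T) k}"
  have fibre: "finite {\<R> \<in> ?A. ?f \<R> = w} \<and> finite {T \<in> ?B. ?g T = w} \<and>
      card {\<R> \<in> ?A. ?f \<R> = w} = card {T \<in> ?B. ?g T = w}" for w
  proof (cases "w \<subseteq> {1..n}")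
    case True
    have "{\<R> \<in> ?A. ?f \<R> = w} = {\<R> \<in> relaxed_trees n. right_height \<R> \<le> 1 \<and>
        (\<forall>k \<in> {1..n}. level (inorder_nodes \<R> ! k) = 0 \<longleftrightarrow> k \<in> w)}"
      using True by auto
    moreover have "{T \<in> ?B. ?g T = w} = {T \<in> ?B.
        \<forall>k \<in> {1..n}. maximal_young_leaf (restrict_tree k T) k \<longleftrightarrow> k \<in> w}"
      using True by auto
    ultimately show ?thesis
      using relaxed_fibre[of n "\<lambda>k. k \<in> w"] plane_increasing_fibre[of n "\<lambda>k. k \<in> w"] by simp
  next
    case False
    then have "{\<R> \<in> ?A. ?f \<R> = w} = {}" "{T \<in> ?B. ?g T = w} = {}" by auto
    then show ?thesis by (simp only: finite.emptyI card.empty simp_thms)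
  qed
  then obtain \<Phi> where "bij_betw \<Phi> ?A ?B" and \<Phi>: "\<forall>\<R>\<in>?A. ?g (\<Phi> \<R>) = ?f \<R>"
    using bij_betw_fibrewise[of ?A ?f ?B ?g] by blast
  moreover have "level (inorder_nodes \<R> ! k) = 0 \<longleftrightarrow> maximal_young_leaf (restrict_tree k (\<Phi> \<R>)) k"
    if "\<R> \<in> ?A" "k \<in> {1..n}" for \<R> k
    using \<Phi>[rule_format, OF that(1)] that(2) by blast
  ultimately show ?thesis by blast
qed

end
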